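(* Let $t\ge 2$ and let $i_1,\dots,i_{t-1}\ge 0$ be integers. Let $\rho$ be the multiset consisting of $i_r$ copies of $r$ for each $1\le r\le t-1$. Then the generating function $P_{R,F}^{(t,t;\rho)}(q)=\sum_\lambda q^{|\lambda|}$, summed over all $t$-regular, $t$-flat partitions $\lambda=(\lambda_1\ge\dots\ge\lambda_k)$ whose residue vector $(\lambda_1 \bmod t,\dots,\lambda_k\bmod t)$ is a permutation of $\rho$, equals $$q^{i_1+2i_2+\dots+(t-1)i_{t-1}}\left[ {{i_1 + \dots + i_{t-1}} \atop {i_1, \dots , i_{t-1}}} \right]_{q^t},$$ where $\left[ {{i_1 + \dots + i_{t-1}} \atop {i_1, \dots , i_{t-1}}} \right]_{x}=\dfrac{(x;x)_{i_1+\dots+i_{t-1}}}{(x;x)_{i_1}\cdots(x;x)_{i_{t-1}}}$.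
   Context: A partition $\lambda_1\ge\dots\ge\lambda_k$ is $t$-regular if no part is divisible by $t$, and $t$-flat if $\lambda_i-\lambda_{i+1}<t$ for $1\le i<k$ and $\lambda_k<t$. Residues are taken in $\{0,1,\dots,t-1\}$. $|\lambda|$ is the sum of parts. Notation: $(a;x)_n=\prod_{i=0}^{n-1}(1-ax^i)$, with $(a;x)_0=1$. *)

theory Defs
  imports "HOL-Library.Multiset" "HOL-Computational_Algebra.Formal_Power_Series"
begin

text \<open>Partitions are weakly decreasing lists of positive integers; the empty list is the
  partition of 0, which is vacuously \<open>t\<close>-regular and \<open>t\<close>-flat.\<close>

definition is_partition :: "nat list \<Rightarrow> bool" where
  "is_partition l \<longleftrightarrow> sorted_wrt (\<ge>) l \<and> (\<forall>x\<in>set l. 0 < x)"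

definition regular_partition :: "nat \<Rightarrow> nat list \<Rightarrow> bool" where
  "regular_partition t l \<longleftrightarrow> (\<forall>x\<in>set l. \<not> t dvd x)"

text \<open>The truncated subtraction below is only used on weakly decreasing lists.\<close>

definition flat_partition :: "nat \<Rightarrow> nat list \<Rightarrow> bool" where
  "flat_partition t l \<longleftrightarrow>
     (\<forall>j. Suc j < length l \<longrightarrow> l ! j - l ! Suc j < t) \<and> (l \<noteq> [] \<longrightarrow> last l < t)"

definition residue_vector :: "nat \<Rightarrow> nat list \<Rightarrow> nat list" where
  "residue_vector t l = map (\<lambda>x. x mod t) l"

definition RF_partitions :: "nat \<Rightarrow> nat multiset \<Rightarrow> nat list set" where
  "RF_partitions t \<rho> =
     {l. is_partition l \<and> regular_partition t l \<and> flat_partition t l \<and>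
         mset (residue_vector t l) = \<rho>}"

text \<open>The series \<open>\<Sum>\<lambda>\<in>A. q^|\<lambda>|\<close>, given by its coefficients; for a set \<open>A\<close> of partitions each of
  the sets counted here is finite.\<close>

definition partition_gf :: "nat list set \<Rightarrow> rat fps" where
  "partition_gf A = Abs_fps (\<lambda>n. of_nat (card {l \<in> A. sum_list l = n}))"

definition P_RF :: "nat \<Rightarrow> nat multiset \<Rightarrow> rat fps" where
  "P_RF t \<rho> = partition_gf (RF_partitions t \<rho>)"

definition residue_multiset :: "nat \<Rightarrow> (nat \<Rightarrow> nat) \<Rightarrow> nat multiset" where
  "residue_multiset t i = (\<Sum>r=1..t-1. replicate_mset (i r) r)"

definition qpoch :: "'a::comm_ring_1 \<Rightarrow> 'a \<Rightarrow> nat \<Rightarrow> 'a" where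
  "qpoch a x n = (\<Prod>j<n. 1 - a * x ^ j)"

text \<open>Division is that of formal power series over a field; if \<open>x\<close> has constant coefficient 0,
  the denominator has constant coefficient 1 and hence is invertible.\<close>

definition qmultinomial :: "nat set \<Rightarrow> (nat \<Rightarrow> nat) \<Rightarrow> rat fps \<Rightarrow> rat fps" where
  "qmultinomial R i x = qpoch x x (\<Sum>r\<in>R. i r) / (\<Prod>r\<in>R. qpoch x x (i r))"

end

theory Submission imports Defs "HOL-Combinatorics.Multiset_Permutations" begin

text \<open>A \<open>t\<close>-regular \<open>t\<close>-flat partition is determined by its residue vector: reading the parts
  from the smallest one upwards, each part is the least number with the prescribed residue that is
  not below its predecessor. Each descent in this reading raises all later parts by \<open>t\<close>, so
  \<open>|\<lambda>|\<close> is the sum of the residues plus \<open>t\<close> times a variant of the major index of the residue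
  word. The theorem thus reduces to MacMahon's theorem on the distribution of the major index over
  the permutations of a multiset. That is shown by induction for the words with a fixed first
  letter \<open>b\<close>, whose generating function is the \<open>q\<close>-multinomial coefficient of the remaining letters
  times \<open>x\<close> to the number of letters below \<open>b\<close>; the sum over the next letter telescopes.\<close>

section \<open>MacMahon's theorem\<close>

text \<open>A descent of the word \<open>w\<close> is weighted by the number of letters after it, so this is the
  usual major index of the ascents of \<open>rev w\<close>.\<close>

fun comaj :: "'a::linorder list \<Rightarrow> nat" where
  "comaj [] = 0"
| "comaj (b # w) = comaj w + (if w \<noteq> [] \<and> hd w < b then length w else 0)"

text \<open>The denominator of the \<open>q\<close>-multinomial coefficient. Kept as a factor on the
  other side of each identity, it spares division, so \<open>x\<close> can lie in any commutative
  ring.\<close>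

definition qpoch_mset :: "'b::comm_ring_1 \<Rightarrow> 'a multiset \<Rightarrow> 'b" where
  "qpoch_mset x M = (\<Prod>r\<in>set_mset M. qpoch x x (count M r))"

lemma qpoch_0 [simp]: "qpoch a x 0 = 1"
  by (simp add: qpoch_def)

lemma qpoch_Suc: "qpoch x x (Suc n) = qpoch x x n * (1 - x ^ Suc n)"
  by (simp add: qpoch_def)

lemma qpoch_mset_superset:
  assumes "finite R" "set_mset M \<subseteq> R"
  shows "qpoch_mset x M = (\<Prod>r\<in>R. qpoch x x (count M r))"
  unfolding qpoch_mset_def using assms
  by (intro prod.mono_neutral_left) (auto simp: not_in_iff)

text \<open>Only the factor of \<open>c\<close> changes. This carries an identity for the letters
  behind a first letter \<open>c\<close> over to the full multiset.\<close>

lemma qpoch_mset_add: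
  "qpoch_mset x (add_mset c M) = (1 - x ^ Suc (count M c)) * qpoch_mset x M"
proof -
  let ?R = "insert c (set_mset M)"
  have "qpoch_mset x (add_mset c M) = (\<Prod>r\<in>?R. qpoch x x (count (add_mset c M) r))"
    by (rule qpoch_mset_superset) auto
  also have "\<dots> = qpoch x x (Suc (count M c)) * (\<Prod>r\<in>?R - {c}. qpoch x x (count M r))"
    by (subst prod.remove[of _ c]) (auto intro!: prod.cong arg_cong2[where f = "(*)"] split: if_splits)
  also have "\<dots> = (1 - x ^ Suc (count M c)) * (\<Prod>r\<in>?R. qpoch x x (count M r))"
    by (subst prod.remove[of ?R c]) (auto simp: qpoch_Suc mult_ac)
  also have "(\<Prod>r\<in>?R. qpoch x x (count M r)) = qpoch_mset x M"
    by (rule qpoch_mset_superset[symmetric]) auto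
  finally show ?thesis .
qed

text \<open>Each summand is a difference of powers of \<open>x\<close>, with exponents the sums of
  \<open>f\<close> strictly below \<open>c\<close> and up to \<open>c\<close>; the latter is the sum
  strictly below the next element of \<open>A\<close>.\<close>

lemma telescope_linorder:
  fixes x :: "'b::comm_ring_1" and f :: "'a::linorder \<Rightarrow> nat"
  assumes "finite A"
  shows "(\<Sum>c\<in>A. x ^ sum f {d\<in>A. d < c} * (1 - x ^ f c)) = 1 - x ^ sum f A"
  using assms
proof (induction A rule: finite_linorder_max_induct)
  case empty
  then show ?case by simp
next
  case (insert b A)
  have below_b: "{d \<in> insert b A. d < b} = A"
    using insert.hyps by auto
  have below: "{d \<in> insert b A. d < c} = {d \<in> A. d < c}" if "c \<in> A" for c
    using insert.hyps that by fastforce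
  have "b \<notin> A" using insert.hyps by auto
  then have "(\<Sum>c\<in>insert b A. x ^ sum f {d\<in>insert b A. d < c} * (1 - x ^ f c)) =
      x ^ sum f A * (1 - x ^ f b) +
      (\<Sum>c\<in>A. x ^ sum f {d\<in>insert b A. d < c} * (1 - x ^ f c))"
    using insert.hyps below_b by (subst sum.insert) (simp_all only: simp_thms)
  also have "(\<Sum>c\<in>A. x ^ sum f {d\<in>insert b A. d < c} * (1 - x ^ f c)) = 1 - x ^ sum f A"
    by (simp only: below insert.IH cong: sum.cong)
  finally show ?case
    using insert.hyps \<open>b \<notin> A\<close> by (simp add: power_add algebra_simps)
qed

text \<open>This partial sum collects the letters that form a descent when placed right after
  \<open>b\<close>.\<close>

lemma telescope_mset_less:
  fixes x :: "'b::comm_ring_1" and M :: "'a::linorder multiset"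
  shows "(\<Sum>c\<in>{c\<in>set_mset M. c < b}. x ^ size {#d \<in># M. d < c#} * (1 - x ^ count M c)) =
    1 - x ^ size {#d \<in># M. d < b#}"
proof -
  let ?A = "{c\<in>set_mset M. c < b}"
  have size_below: "size {#d \<in># M. d < c#} = sum (count M) {d\<in>set_mset M. d < c}" for c
    by (simp add: size_multiset_overloaded_eq)
  have "{d\<in>?A. d < c} = {d\<in>set_mset M. d < c}" if "c \<in> ?A" for c
    using that by auto
  then have "(\<Sum>c\<in>?A. x ^ sum (count M) {d\<in>set_mset M. d < c} * (1 - x ^ count M c)) =
      (\<Sum>c\<in>?A. x ^ sum (count M) {d\<in>?A. d < c} * (1 - x ^ count M c))"
    by (intro sum.cong refl) presburger
  then show ?thesis
    using telescope_linorder[of ?A x "count M"] by (simp only: size_below) simp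
qed

lemma telescope_mset:
  fixes x :: "'b::comm_ring_1" and M :: "'a::linorder multiset"
  shows "(\<Sum>c\<in>set_mset M. x ^ size {#d \<in># M. d < c#} * (1 - x ^ count M c)) = 1 - x ^ size M"
  using telescope_linorder[of "set_mset M" x "count M"]
  by (simp add: size_multiset_overloaded_eq)

lemma sum_permutations_of_multiset:
  assumes "M \<noteq> {#}"
  shows "(\<Sum>w\<in>permutations_of_multiset M. f w) =
    (\<Sum>c\<in>set_mset M. \<Sum>w\<in>permutations_of_multiset (M - {#c#}). f (c # w))"
  unfolding permutations_of_multiset_nonempty[OF assms]
  by (subst sum.UNION_disjoint) (auto simp: sum.reindex)

text \<open>Here \<open>b\<close> is put in front and not taken from \<open>M\<close>. Splitting by
  the second letter \<open>c\<close> makes \<open>c\<close> the fixed first letter of a shorter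
  problem, hence the induction over all \<open>b\<close>.\<close>

lemma comaj_gf_first_letter:
  fixes x :: "'b::comm_ring_1" and M :: "'a::linorder multiset"
  shows "qpoch_mset x M * (\<Sum>w\<in>permutations_of_multiset M. x ^ comaj (b # w)) =
    x ^ size {#d \<in># M. d < b#} * qpoch x x (size M)"
proof (induction "size M" arbitrary: M b)
  case 0
  then show ?case by (simp add: qpoch_mset_def)
next
  case (Suc n)
  then have M: "M \<noteq> {#}" by auto
  define G where "G c = (\<Sum>w\<in>permutations_of_multiset (M - {#c#}). x ^ comaj (c # w))" for c
  define S where "S c = size {#d \<in># M. d < c#}" for c
  define T where "T c = x ^ S c * (1 - x ^ count M c)" for c
  have G: "qpoch_mset x M * G c = qpoch x x n * T c" if "c \<in># M" for c
  proof -
    from that obtain N where N: "M = add_mset c N" by (metis mset_add)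
    have "qpoch_mset x N * G c = x ^ size {#d \<in># N. d < c#} * qpoch x x n"
      using Suc.hyps(1)[of N c] Suc.hyps(2) by (simp add: G_def N)
    \<comment> \<open>The factor turns the denominator for \<open>N\<close> into that for
      \<open>M\<close>; as \<open>c\<close> is not below itself, the exponent is the same for
      both.\<close>
    from arg_cong[OF this, of "(*) (1 - x ^ Suc (count N c))"] show ?thesis
      by (simp add: qpoch_mset_add T_def S_def N mult_ac)
  qed
  \<comment> \<open>A descent from \<open>b\<close> to \<open>c\<close> weighs \<open>Suc n\<close>,
    the number of letters after \<open>b\<close>.\<close>
  have step: "(\<Sum>w\<in>permutations_of_multiset (M - {#c#}). x ^ comaj (b # c # w)) =
      (if c < b then x ^ Suc n else 1) * G c" if "c \<in># M" for c
  proof -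
    have "length w = n" if "w \<in> permutations_of_multiset (M - {#c#})" for w
    proof -
      have "length w = size (M - {#c#})"
        using that by (metis permutations_of_multisetD size_mset)
      with \<open>c \<in># M\<close> Suc.hyps(2) show ?thesis by (simp add: size_Diff_singleton)
    qed
    then show ?thesis
      by (auto simp: G_def sum_distrib_left power_add mult_ac intro!: sum.cong)
  qed
  let ?L = "{c\<in>set_mset M. c < b}" and ?U = "{c\<in>set_mset M. \<not> c < b}"
  have less: "sum T ?L = 1 - x ^ S b"
    unfolding T_def S_def by (rule telescope_mset_less)
  have "sum T (set_mset M) = 1 - x ^ Suc n"
    using telescope_mset[of x M] Suc.hyps(2) by (simp add: T_def S_def)
  moreover have split: "sum h (set_mset M) = sum h ?L + sum h ?U" for h :: "'a \<Rightarrow> 'b"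
    by (subst sum.union_disjoint[symmetric]) (auto intro: sum.cong)
  ultimately have ge: "sum T ?U = x ^ S b - x ^ Suc n"
    using less by (simp add: algebra_simps)
  have "qpoch_mset x M * (\<Sum>w\<in>permutations_of_multiset M. x ^ comaj (b # w)) =
      qpoch_mset x M * (\<Sum>c\<in>set_mset M. (if c < b then x ^ Suc n else 1) * G c)"
    by (subst sum_permutations_of_multiset[OF M]) (simp only: step cong: sum.cong)
  also have "\<dots> = (\<Sum>c\<in>set_mset M. (if c < b then x ^ Suc n else 1) * (qpoch x x n * T c))"
    unfolding sum_distrib_left
    by (intro sum.cong refl) (metis G mult.left_commute)
  also have "\<dots> = x ^ Suc n * qpoch x x n * sum T ?L + qpoch x x n * sum T ?U"
    unfolding split sum_distrib_left
    by (intro arg_cong2[where f = "(+)"] sum.cong) (auto simp: mult_ac)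
  \<comment> \<open>The two parts \<open>x ^ Suc n * (1 - x ^ S b)\<close> and
    \<open>x ^ S b - x ^ Suc n\<close> add up to \<open>x ^ S b * (1 - x ^ Suc n)\<close>.\<close>
  also have "\<dots> = x ^ S b * (qpoch x x n * (1 - x ^ Suc n))"
    unfolding less ge by (simp add: algebra_simps)
  finally show ?case
    using Suc.hyps(2)[symmetric] by (simp only: qpoch_Suc S_def)
qed

text \<open>Nothing stands before the first letter, so splitting by it creates no descent and the
  telescoping sum runs over all letters.\<close>

theorem MacMahon_comaj:
  fixes x :: "'b::comm_ring_1" and M :: "'a::linorder multiset"
  shows "qpoch_mset x M * (\<Sum>w\<in>permutations_of_multiset M. x ^ comaj w) = qpoch x x (size M)"
proof (cases "M = {#}")
  case True
  then show ?thesis by (simp add: qpoch_mset_def)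
next
  case False
  then obtain n where n: "size M = Suc n" by (metis Suc_pred nonempty_has_size)
  define G where "G c = (\<Sum>w\<in>permutations_of_multiset (M - {#c#}). x ^ comaj (c # w))" for c
  have G: "qpoch_mset x M * G c =
      qpoch x x n * (x ^ size {#d \<in># M. d < c#} * (1 - x ^ count M c))" if "c \<in># M" for c
  proof -
    from that obtain N where N: "M = add_mset c N" by (metis mset_add)
    with n have "qpoch_mset x N * G c = x ^ size {#d \<in># N. d < c#} * qpoch x x n"
      using comaj_gf_first_letter[of x N c] by (simp add: G_def)
    from arg_cong[OF this, of "(*) (1 - x ^ Suc (count N c))"] show ?thesis
      by (simp add: qpoch_mset_add N mult_ac)
  qed
  have "qpoch_mset x M * (\<Sum>w\<in>permutations_of_multiset M. x ^ comaj w) =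
      (\<Sum>c\<in>set_mset M. qpoch_mset x M * G c)"
    by (subst sum_permutations_of_multiset[OF False]) (simp add: G_def sum_distrib_left)
  also have "\<dots> = qpoch x x n * (1 - x ^ Suc n)"
    using telescope_mset[of x M] n by (simp add: G sum_distrib_left[symmetric])
  finally show ?thesis by (simp add: n qpoch_Suc)
qed

section \<open>Flat partitions and residue words\<close>

text \<open>The word \<open>w\<close> and the resulting parts are listed from the smallest part upwards.\<close>

fun flat_parts :: "nat \<Rightarrow> nat list \<Rightarrow> nat list" where
  "flat_parts t [] = []"
| "flat_parts t (b # w) =
     b # map (\<lambda>y. y + (if hd w < b then t else 0)) (flat_parts t w)"

lemma length_flat_parts [simp]: "length (flat_parts t w) = length w"
  by (induction w) auto

lemma flat_parts_eq_Nil_iff [simp]: "flat_parts t w = [] \<longleftrightarrow> w = []"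
  by (cases w) auto

lemma hd_flat_parts [simp]: "w \<noteq> [] \<Longrightarrow> hd (flat_parts t w) = hd w"
  by (cases w) auto

text \<open>A descent at the front lifts \<open>length w\<close> parts by \<open>t\<close> each,
  which is \<open>t\<close> times its weight in \<open>comaj\<close>. For empty \<open>w\<close>
  there is no part to lift, whatever \<open>hd w\<close> is.\<close>

lemma sum_list_flat_parts: "sum_list (flat_parts t w) = sum_list w + t * comaj w"
  by (induction w) (auto simp: sum_list_addf sum_list_triv algebra_simps)

lemma flat_parts_mod:
  "(\<And>a. a \<in> set w \<Longrightarrow> a < t) \<Longrightarrow> map (\<lambda>y. y mod t) (flat_parts t w) = w"
proof (induction w)
  case (Cons b w)
  then have "map ((\<lambda>y. y mod t) \<circ> (\<lambda>y. y + (if hd w < b then t else 0))) (flat_parts t w) = w"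
    by (cases "hd w < b") (auto simp: comp_def)
  with Cons.prems show ?case by simp
qed simp

lemma successively_flat_parts:
  "(\<And>a. a \<in> set w \<Longrightarrow> a < t) \<Longrightarrow> successively (\<lambda>x y. x \<le> y \<and> y - x < t) (flat_parts t w)"
proof (induction w)
  case (Cons b w)
  let ?s = "if hd w < b then t else 0"
  have "successively (\<lambda>x y. x \<le> y \<and> y - x < t) (map (\<lambda>y. y + ?s) (flat_parts t w))"
    using Cons by (simp add: successively_map)
  \<comment> \<open>Both letters are below \<open>t\<close>, so a single shift by \<open>t\<close>
    repairs a descent and leaves a gap below \<open>t\<close>.\<close>
  moreover have "b \<le> hd w + ?s \<and> hd w + ?s - b < t" if "w \<noteq> []"
  proof -
    have "b < t" "hd w < t" using Cons.prems that by simp_all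
    then show ?thesis by auto
  qed
  moreover have "hd (map (\<lambda>y. y + ?s) (flat_parts t w)) = hd w + ?s" if "w \<noteq> []"
    using that by (subst hd_map) simp_all
  ultimately show ?case
    by (cases "w = []") (simp_all only: flat_parts.simps successively_Cons map_is_Nil_conv
        flat_parts_eq_Nil_iff simp_thms)
qed simp

text \<open>Order and gaps become conditions on neighbours; positivity and regularity together say
  that no residue is 0, a condition on \<rho> alone.\<close>

lemma RF_partitions_altdef:
  assumes "t > 0"
  shows "l \<in> RF_partitions t \<rho> \<longleftrightarrow>
    successively (\<lambda>x y. y \<le> x \<and> x - y < t) l \<and> (l \<noteq> [] \<longrightarrow> last l < t) \<and>
    0 \<notin># \<rho> \<and> mset (map (\<lambda>x. x mod t) l) = \<rho>"
proof -
  have "sorted_wrt (\<ge>) l \<longleftrightarrow> successively (\<ge>) l"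
    by (rule successively_conv_sorted_wrt[symmetric]) (auto simp: transp_def)
  moreover have "(\<forall>x\<in>set l. 0 < x) \<and> (\<forall>x\<in>set l. \<not> t dvd x) \<longleftrightarrow> 0 \<notin># mset (map (\<lambda>x. x mod t) l)"
    by (force simp: dvd_eq_mod_eq_0 intro: gr0I)
  ultimately show ?thesis
    unfolding RF_partitions_def is_partition_def regular_partition_def flat_partition_def
      residue_vector_def successively_conv_nth
    by auto
qed

text \<open>From the smallest part upwards, each part is confined to \<open>t\<close> consecutive
  numbers, and only one of these has the given residue.\<close>

lemma residues_determine_flat_partition:
  fixes t :: nat
  assumes "successively (\<lambda>x y. y \<le> x \<and> x - y < t) l" "l \<noteq> [] \<longrightarrow> last l < t"
    and "successively (\<lambda>x y. y \<le> x \<and> x - y < t) l'" "l' \<noteq> [] \<longrightarrow> last l' < t"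
    and "map (\<lambda>x. x mod t) l = map (\<lambda>x. x mod t) l'"
  shows "l = l'"
proof -
  have "length l = length l'" using assms(5) by (rule map_eq_imp_length_eq)
  then show ?thesis using assms
  proof (induction l l' rule: list_induct2)
    case (Cons a l a' l')
    have tl: "l = l'"
      using Cons.prems by (intro Cons.IH) (auto simp: successively_Cons split: if_splits)
    have mods: "a mod t = a' mod t" using Cons.prems by simp
    show ?case
    proof (cases "l = []")
      case True
      then have "a < t" "a' < t" using Cons.prems tl by auto
      with mods tl show ?thesis by simp
    next
      case False
      then have *: "hd l \<le> a" "a - hd l < t" "hd l \<le> a'" "a' - hd l < t"
        using Cons.prems(1,3) unfolding tl[symmetric] successively_Cons by blast+
      have eq: "m = n" if "m mod t = n mod t" "n \<le> m" "m - n < t" for m n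
        using that mod_eq_dvd_iff_nat[of n m t] dvd_imp_le[of t "m - n"] by auto
      have "a = a'"
      proof (cases "a' \<le> a")
        case True
        then show ?thesis using eq[of a a'] mods * by linarith
      next
        case False
        then show ?thesis using eq[of a' a] mods * by linarith
      qed
      with tl show ?thesis by simp
    qed
  qed simp
qed

lemma RF_partitions_bij:
  assumes "\<And>r. r \<in># \<rho> \<Longrightarrow> 0 < r \<and> r < t" and "t > 0"
  shows "bij_betw (\<lambda>w. rev (flat_parts t w)) (permutations_of_multiset \<rho>) (RF_partitions t \<rho>)"
proof (rule bij_betwI')
  have letters: "a < t" if "w \<in> permutations_of_multiset \<rho>" "a \<in> set w" for w a
    using that assms(1) by (metis permutations_of_multisetD set_mset_mset)
  fix v w
  assume v: "v \<in> permutations_of_multiset \<rho>"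
  {
    assume w: "w \<in> permutations_of_multiset \<rho>"
    show "rev (flat_parts t v) = rev (flat_parts t w) \<longleftrightarrow> v = w"
      using flat_parts_mod[of v t] flat_parts_mod[of w t] letters[OF v] letters[OF w]
      by (metis rev_rev_ident)
  }
  show "rev (flat_parts t v) \<in> RF_partitions t \<rho>"
  proof -
    have "mset (map (\<lambda>x. x mod t) (rev (flat_parts t v))) = \<rho>"
      using flat_parts_mod[of v t] letters[OF v] permutations_of_multisetD[OF v]
      by (metis mset_rev rev_map)
    then show ?thesis
      using letters[OF v] assms successively_flat_parts[of v t]
      by (auto simp: RF_partitions_altdef last_rev)
  qed
next
  fix l assume l: "l \<in> RF_partitions t \<rho>"
  \<comment> \<open>Reversed, since words start at the smallest part. Its flat partition has the
    same residues as \<open>l\<close> and hence equals \<open>l\<close>.\<close>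
  define w where "w = rev (map (\<lambda>x. x mod t) l)"
  have w: "w \<in> permutations_of_multiset \<rho>"
    using l \<open>t > 0\<close> by (simp add: RF_partitions_altdef permutations_of_multiset_def w_def)
  have letters: "a < t" if "a \<in> set w" for a
    using that \<open>t > 0\<close> by (auto simp: w_def)
  have "l = rev (flat_parts t w)"
  proof (rule residues_determine_flat_partition)
    show "successively (\<lambda>x y. y \<le> x \<and> x - y < t) (rev (flat_parts t w))"
      using successively_flat_parts[of w t] letters by simp
    show "map (\<lambda>x. x mod t) l = map (\<lambda>x. x mod t) (rev (flat_parts t w))"
      using flat_parts_mod[of w t] letters by (metis rev_map rev_rev_ident w_def)
    show "rev (flat_parts t w) \<noteq> [] \<longrightarrow> last (rev (flat_parts t w)) < t"
      using letters by (auto simp: last_rev)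
  qed (use l \<open>t > 0\<close> in \<open>auto simp: RF_partitions_altdef\<close>)
  with w show "\<exists>w\<in>permutations_of_multiset \<rho>. l = rev (flat_parts t w)" by blast
qed

section \<open>Generating functions\<close>

lemma partition_gf_finite:
  assumes "finite A"
  shows "partition_gf A = (\<Sum>l\<in>A. fps_X ^ sum_list l)"
proof (rule fps_ext)
  fix n
  have "(\<Sum>l\<in>A. fps_nth (fps_X ^ sum_list l) n) = (\<Sum>l\<in>A. if sum_list l = n then 1 else 0 :: rat)"
    by (intro sum.cong) auto
  also have "\<dots> = of_nat (card {l\<in>A. sum_list l = n})"
    using assms by (simp add: sum.If_cases Int_def)
  finally show "fps_nth (partition_gf A) n = fps_nth (\<Sum>l\<in>A. fps_X ^ sum_list l) n"
    by (simp add: partition_gf_def fps_sum_nth)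
qed

lemma P_RF_eq_comaj_gf:
  assumes "\<And>r. r \<in># \<rho> \<Longrightarrow> 0 < r \<and> r < t" and "t > 0"
  shows "P_RF t \<rho> =
    fps_X ^ sum_mset \<rho> * (\<Sum>w\<in>permutations_of_multiset \<rho>. (fps_X ^ t) ^ comaj w)"
proof -
  have bij: "bij_betw (\<lambda>w. rev (flat_parts t w)) (permutations_of_multiset \<rho>) (RF_partitions t \<rho>)"
    using assms by (rule RF_partitions_bij)
  have "finite (RF_partitions t \<rho>)"
    using bij_betw_finite[OF bij] by simp
  then have "P_RF t \<rho> = (\<Sum>l\<in>RF_partitions t \<rho>. fps_X ^ sum_list l)"
    by (simp add: P_RF_def partition_gf_finite)
  also have "\<dots> = (\<Sum>w\<in>permutations_of_multiset \<rho>. fps_X ^ (sum_list w + t * comaj w))"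
    by (subst sum.reindex_bij_betw[OF bij, symmetric]) (simp add: sum_list_rev sum_list_flat_parts)
  \<comment> \<open>All permutations of \<rho> have the same sum, so this power factors out.\<close>
  also have "\<dots> = (\<Sum>w\<in>permutations_of_multiset \<rho>. fps_X ^ sum_mset \<rho> * (fps_X ^ t) ^ comaj w)"
    by (intro sum.cong refl)
      (auto simp: power_add power_mult sum_mset_sum_list[symmetric] dest: permutations_of_multisetD)
  finally show ?thesis by (simp add: sum_distrib_left)
qed

lemma sum_mset_sum_replicate:
  "sum_mset (\<Sum>r\<in>R. replicate_mset (f r) r) = (\<Sum>r\<in>R. of_nat (f r) * r)"
  by (induction R rule: infinite_finite_induct) auto

lemma count_residue_multiset:
  "count (residue_multiset t i) r = (if r \<in> {1..t-1} then i r else 0)"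
  by (auto simp: residue_multiset_def count_sum)

text \<open>Each factor has constant coefficient 1. This allows cancelling the denominator of the
  \<open>q\<close>-multinomial coefficient.\<close>

lemma qpoch_fps_X_power_neq_0:
  assumes "t > 0"
  shows "qpoch (fps_X ^ t) (fps_X ^ t) n \<noteq> (0 :: 'a::idom fps)"
proof -
  have "1 - fps_X ^ t * (fps_X ^ t) ^ j \<noteq> (0 :: 'a fps)" for j
  proof
    assume "1 - fps_X ^ t * (fps_X ^ t) ^ j = (0 :: 'a fps)"
    then have "fps_nth (1 - fps_X ^ t * (fps_X ^ t) ^ j :: 'a fps) 0 = 0" by simp
    with assms show False by simp
  qed
  then show ?thesis by (simp add: qpoch_def)
qed

theorem theorem11:
  fixes t :: nat and i :: "nat \<Rightarrow> nat"
  assumes "t \<ge> 2"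
  shows "P_RF t (residue_multiset t i) =
    fps_X ^ (\<Sum>r=1..t-1. r * i r) * qmultinomial {1..t-1} i (fps_X ^ t)"
proof -
  define \<rho> where "\<rho> = residue_multiset t i"
  define x :: "rat fps" where "x = fps_X ^ t"
  define A where "A = (\<Sum>w\<in>permutations_of_multiset \<rho>. x ^ comaj w)"
  define D where "D = (\<Prod>r=1..t-1. qpoch x x (i r))"
  have letters: "r \<in> {1..t-1}" if "r \<in># \<rho>" for r
    using that by (metis \<rho>_def count_residue_multiset not_in_iff)
  have size: "size \<rho> = (\<Sum>r=1..t-1. i r)"
    by (simp add: \<rho>_def residue_multiset_def)
  have sum: "sum_mset \<rho> = (\<Sum>r=1..t-1. r * i r)"
    by (simp add: \<rho>_def residue_multiset_def sum_mset_sum_replicate mult.commute)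
  \<comment> \<open>Residues with \<open>i r = 0\<close> do not occur in \<rho>; in \<open>D\<close>
    they contribute the empty product 1.\<close>
  have "qpoch_mset x \<rho> = D"
    using letters by (subst qpoch_mset_superset[of "{1..t-1}"])
      (auto simp: D_def \<rho>_def count_residue_multiset)
  then have "D * A = qpoch x x (\<Sum>r=1..t-1. i r)"
    using MacMahon_comaj[of x \<rho>] by (simp add: A_def size)
  moreover have "D \<noteq> 0"
    using assms by (simp add: D_def x_def qpoch_fps_X_power_neq_0)
  ultimately have "qmultinomial {1..t-1} i x = A"
    by (metis D_def qmultinomial_def nonzero_mult_div_cancel_left)
  moreover have "P_RF t \<rho> = fps_X ^ sum_mset \<rho> * A"
    unfolding A_def x_def using letters assms by (intro P_RF_eq_comaj_gf) force+
  ultimately show ?thesis by (simp add: \<rho>_def[symmetric] x_def sum)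
qed

end
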